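(* $\cong_{\mathcal{CS}_1}\ \equiv_c\ E_{\min}$.
   Context: $W_e$ denotes the $e$-th c.e. set. $\mathcal{CS}$ is the variety of commutative semigroups (one binary operation). Fix a computable bijective coding of pairs of terms over the single generator $x_0$ by natural numbers; $\mathcal{CS}_1[e]$ is the term algebra over $\{x_0\}$ modulo the smallest congruence containing the pairs coded in $W_e$ and all instances of the commutative semigroup laws, and $e\cong_{\mathcal{CS}_1}i$ iff $\mathcal{CS}_1[e]\cong\mathcal{CS}_1[i]$. $e\,E_{\min}\,i$ iff $\min W_e=\min W_i$ or $W_e=W_i=\emptyset$. For equivalence relations $E,F$ on $\mathbb N$, $E\le_c F$ means there is a total computable $h$ with $x\,E\,y\iff h(x)\,F\,h(y)$; $E\equiv_c F$ means $E\le_c F$ and $F\le_c E$. *)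

theory Defs
  imports "HOL-Library.Nat_Bijection"
begin

section \<open>Partial computable functions and c.e. sets\<close>

text \<open>
  Programs for unary partial recursive functions. Functions of several arguments are
  represented through the pairing bijection \<^const>\<open>prod_encode\<close>, whose projections
  are \<open>Fst\<close> and \<open>Snd\<close>; \<open>Prec\<close> is primitive recursion and
  \<open>Mu\<close> unbounded minimisation, so that the functions computed are exactly the unary
  partial computable ones.
\<close>

datatype recf =
    Zero
  | Succ
  | Fst
  | Snd
  | Tuple recf recf
  | Comp recf recf
  | Prec recf recf
  | Mu recf

primrec run :: "recf \<Rightarrow> nat \<Rightarrow> nat option" where
  "run Zero = (\<lambda>x. Some 0)"
| "run Succ = (\<lambda>x. Some (Suc x))"
| "run Fst = (\<lambda>x. Some (fst (prod_decode x)))"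
| "run Snd = (\<lambda>x. Some (snd (prod_decode x)))"
| "run (Tuple f g) = (\<lambda>x.
     Option.bind (run f x) (\<lambda>y. Option.bind (run g x) (\<lambda>z. Some (prod_encode (y, z)))))"
| "run (Comp f g) = (\<lambda>x. Option.bind (run g x) (run f))"
| "run (Prec f g) = (\<lambda>z. case prod_decode z of (x, n) \<Rightarrow>
     rec_nat (run f x)
       (\<lambda>m r. Option.bind r (\<lambda>y. run g (prod_encode (x, prod_encode (m, y))))) n)"
| "run (Mu f) = (\<lambda>x.
     let P = (\<lambda>n. run f (prod_encode (x, n)) = Some 0 \<and>
                  (\<forall>m<n. \<exists>k. run f (prod_encode (x, m)) = Some (Suc k)))
     in if \<exists>n. P n then Some (LEAST n. P n) else None)"

definition computable :: "(nat \<Rightarrow> nat) \<Rightarrow> bool" where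
  "computable h \<longleftrightarrow> (\<exists>p. \<forall>x. run p x = Some (h x))"

primrec goedel :: "recf \<Rightarrow> nat" where
  "goedel Zero = 0"
| "goedel Succ = 1"
| "goedel Fst = 2"
| "goedel Snd = 3"
| "goedel (Tuple f g) = 4 + 4 * prod_encode (goedel f, goedel g)"
| "goedel (Comp f g) = 5 + 4 * prod_encode (goedel f, goedel g)"
| "goedel (Prec f g) = 6 + 4 * prod_encode (goedel f, goedel g)"
| "goedel (Mu f) = 7 + 4 * goedel f"

lemma inj_goedel: "inj goedel"
proof (rule injI)
  have neq: "4 + 4 * a \<noteq> 5 + 4 * b" "4 + 4 * a \<noteq> 6 + 4 * b" "4 + 4 * a \<noteq> 7 + 4 * b"
    "5 + 4 * a \<noteq> 6 + 4 * b" "5 + 4 * a \<noteq> 7 + 4 * b" "6 + 4 * a \<noteq> 7 + 4 * b" for a b :: nat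
    by presburger+
  fix p q show "goedel p = goedel q \<Longrightarrow> p = q"
  proof (induction p arbitrary: q)
    case (Tuple f g)
    then show ?case using neq by (cases q) (simp_all del: add_Suc_right)
  next
    case (Comp f g)
    then show ?case using neq neq[symmetric] by (cases q) (simp_all del: add_Suc_right)
  next
    case (Prec f g)
    then show ?case using neq neq[symmetric] by (cases q) (simp_all del: add_Suc_right)
  next
    case (Mu f)
    then show ?case using neq[symmetric] by (cases q) (simp_all del: add_Suc_right)
  qed (case_tac q; simp)+
qed

lemma surj_goedel: "surj goedel"
proof -
  have "\<exists>p. goedel p = n" for n
  proof (induction n rule: less_induct)
    case (less n)
    show ?case
    proof (cases "n < 4")
      case True
      then have "n = 0 \<or> n = 1 \<or> n = 2 \<or> n = 3" by auto
      then show ?thesis by (metis goedel.simps(1-4))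
    next
      case False
      define k where "k = (n - 4) div 4"
      obtain a b where ab: "prod_decode k = (a, b)" by fastforce
      then have k: "k = prod_encode (a, b)" by (metis prod_decode_inverse)
      have "k < n" using False by (simp add: k_def)
      moreover have "a \<le> k" "b \<le> k" unfolding k by (rule le_prod_encode_1 le_prod_encode_2)+
      ultimately obtain f g h where fgh: "goedel f = a" "goedel g = b" "goedel h = k"
        using less by (meson le_less_trans)
      have "n = 4 + 4 * k \<or> n = 5 + 4 * k \<or> n = 6 + 4 * k \<or> n = 7 + 4 * k"
        using False unfolding k_def by presburger
      then show ?thesis
        using fgh k by (metis goedel.simps(5-8))
    qed
  qed
  then show ?thesis by (metis surjI)
qed

lemma bij_goedel: "bij goedel"
  using inj_goedel surj_goedel by (rule bijI)

definition W :: "nat \<Rightarrow> nat set" where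
  "W e = dom (run (inv goedel e))"

section \<open>Computable reducibility of equivalence relations\<close>

definition reducible :: "(nat \<Rightarrow> nat \<Rightarrow> bool) \<Rightarrow> (nat \<Rightarrow> nat \<Rightarrow> bool) \<Rightarrow> bool"
    (infix "\<le>\<^sub>c" 50) where
  "E \<le>\<^sub>c F \<longleftrightarrow> (\<exists>h. computable h \<and> (\<forall>x y. E x y \<longleftrightarrow> F (h x) (h y)))"

definition bireducible :: "(nat \<Rightarrow> nat \<Rightarrow> bool) \<Rightarrow> (nat \<Rightarrow> nat \<Rightarrow> bool) \<Rightarrow> bool"
    (infix "\<equiv>\<^sub>c" 50) where
  "E \<equiv>\<^sub>c F \<longleftrightarrow> E \<le>\<^sub>c F \<and> F \<le>\<^sub>c E"

definition E_min :: "nat \<Rightarrow> nat \<Rightarrow> bool" where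
  "E_min e i \<longleftrightarrow>
     (W e \<noteq> {} \<and> W i \<noteq> {} \<and> (LEAST n. n \<in> W e) = (LEAST n. n \<in> W i)) \<or>
     (W e = {} \<and> W i = {})"

section \<open>One-generated c.e. presented commutative semigroups\<close>

datatype trm = X0 | Mul trm trm

text \<open>
  To say which codings of pairs of terms are computable one needs a reference coding:
  \<open>std_coding\<close>. A coding is computable if it is so after transport along the
  latter; for a bijection the same then holds for the inverse.
\<close>

primrec std_trm :: "trm \<Rightarrow> nat" where
  "std_trm X0 = 0"
| "std_trm (Mul s t) = Suc (prod_encode (std_trm s, std_trm t))"

definition std_coding :: "trm \<times> trm \<Rightarrow> nat" where
  "std_coding = (\<lambda>(s, t). prod_encode (std_trm s, std_trm t))"

lemma inj_std_trm: "inj std_trm"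
proof (rule injI)
  fix s t show "std_trm s = std_trm t \<Longrightarrow> s = t"
  proof (induction s arbitrary: t)
    case X0 then show ?case by (cases t) auto
  next
    case (Mul s1 s2) then show ?case by (cases t) auto
  qed
qed

lemma surj_std_trm: "surj std_trm"
proof -
  have "\<exists>t. std_trm t = n" for n
  proof (induction n rule: less_induct)
    case (less n)
    show ?case
    proof (cases n)
      case 0 then show ?thesis by (metis std_trm.simps(1))
    next
      case (Suc k)
      obtain a b where k: "k = prod_encode (a, b)" by (metis prod_decode_inverse surj_pair)
      have "a < n" "b < n"
        using le_prod_encode_1[of a b] le_prod_encode_2[of b a] by (simp_all add: Suc k)
      then show ?thesis using less Suc k by (metis std_trm.simps(2))
    qed
  qed
  then show ?thesis by (metis surjI)
qed

lemma bij_std_coding: "bij std_coding"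
proof -
  have "std_coding = prod_encode \<circ> map_prod std_trm std_trm"
    by (auto simp: std_coding_def)
  moreover have "bij (map_prod std_trm std_trm)"
    using inj_std_trm surj_std_trm by (intro bijI prod.inj_map map_prod_surj)
  ultimately show ?thesis by (metis bij_comp bij_prod_encode)
qed

definition computable_coding :: "(trm \<times> trm \<Rightarrow> nat) \<Rightarrow> bool" where
  "computable_coding c \<longleftrightarrow> bij c \<and> computable (\<lambda>n. c (inv std_coding n))"

lemma computable_coding_std: "computable_coding std_coding"
proof -
  have "run (Tuple Fst Snd) x = Some x" for x by simp
  then show ?thesis
    unfolding computable_coding_def computable_def
    using bij_std_coding by (metis bij_inv_eq_iff)
qed

definition congruence :: "(trm \<times> trm) set \<Rightarrow> bool" where
  "congruence R \<longleftrightarrow> equiv UNIV R \<and>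
     (\<forall>s s' t t'. (s, s') \<in> R \<longrightarrow> (t, t') \<in> R \<longrightarrow> (Mul s t, Mul s' t') \<in> R)"

definition CS_laws :: "(trm \<times> trm) set" where
  "CS_laws = {(Mul (Mul r s) t, Mul r (Mul s t)) | r s t. True} \<union>
             {(Mul s t, Mul t s) | s t. True}"

definition CS1_cong :: "(trm \<times> trm \<Rightarrow> nat) \<Rightarrow> nat \<Rightarrow> (trm \<times> trm) set" where
  "CS1_cong c e = \<Inter>{R. congruence R \<and> {p. c p \<in> W e} \<subseteq> R \<and> CS_laws \<subseteq> R}"

lemma congruence_CS1_cong: "congruence (CS1_cong c e)"
proof -
  have mem: "x \<in> CS1_cong c e \<longleftrightarrow>
      (\<forall>R. congruence R \<longrightarrow> {p. c p \<in> W e} \<subseteq> R \<longrightarrow> CS_laws \<subseteq> R \<longrightarrow> x \<in> R)" for x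
    unfolding CS1_cong_def by (simp add: imp_conjL)
  have eq: "refl R" "sym R" "trans R" if "congruence R" for R
    using that by (auto simp: congruence_def equiv_def)
  have mul: "(Mul s t, Mul s' t') \<in> R"
    if "congruence R" "(s, s') \<in> R" "(t, t') \<in> R" for R s s' t t'
    using that by (simp add: congruence_def)
  have "refl (CS1_cong c e)"
    by (rule refl_onI) (simp add: mem eq(1)[THEN refl_onD])
  moreover have "sym (CS1_cong c e)"
    by (rule symI) (simp add: mem eq(2)[THEN symD])
  moreover have "trans (CS1_cong c e)"
    by (rule transI, unfold mem) (blast dest: eq(3)[THEN transD])
  moreover have "(Mul s t, Mul s' t') \<in> CS1_cong c e"
    if "(s, s') \<in> CS1_cong c e" "(t, t') \<in> CS1_cong c e" for s s' t t'
    using that unfolding mem by (simp add: mul)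
  ultimately show ?thesis
    unfolding congruence_def by (simp add: equiv_def)
qed

definition CS1_carrier :: "(trm \<times> trm \<Rightarrow> nat) \<Rightarrow> nat \<Rightarrow> trm set set" where
  "CS1_carrier c e = UNIV // CS1_cong c e"

definition CS1_mult ::
    "(trm \<times> trm \<Rightarrow> nat) \<Rightarrow> nat \<Rightarrow> trm set \<Rightarrow> trm set \<Rightarrow> trm set" where
  "CS1_mult c e A B = (\<Union>s\<in>A. \<Union>t\<in>B. CS1_cong c e `` {Mul s t})"

lemma CS1_mult_class:
  "CS1_mult c e (CS1_cong c e `` {s}) (CS1_cong c e `` {t}) = CS1_cong c e `` {Mul s t}"
proof -
  have C: "equiv UNIV (CS1_cong c e)"
    "\<And>s s' t t'. (s, s') \<in> CS1_cong c e \<Longrightarrow> (t, t') \<in> CS1_cong c e \<Longrightarrow>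
       (Mul s t, Mul s' t') \<in> CS1_cong c e"
    using congruence_CS1_cong unfolding congruence_def by blast+
  have "CS1_cong c e `` {Mul s' t'} = CS1_cong c e `` {Mul s t}"
    if "(s, s') \<in> CS1_cong c e" "(t, t') \<in> CS1_cong c e" for s' t'
    using equiv_class_eq[OF C(1) C(2)[OF that]] by simp
  moreover have "(s, s) \<in> CS1_cong c e" "(t, t) \<in> CS1_cong c e"
    using C(1) by (auto simp: equiv_def refl_on_def)
  ultimately show ?thesis unfolding CS1_mult_def by blast
qed

definition CS1_iso :: "(trm \<times> trm \<Rightarrow> nat) \<Rightarrow> nat \<Rightarrow> nat \<Rightarrow> bool" where
  "CS1_iso c e i \<longleftrightarrow>
     (\<exists>f. bij_betw f (CS1_carrier c e) (CS1_carrier c i) \<and>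
          (\<forall>A\<in>CS1_carrier c e. \<forall>B\<in>CS1_carrier c e.
             f (CS1_mult c e A B) = CS1_mult c i (f A) (f B)))"

end

theory Submission imports Defs begin

text \<open>
  Modulo the commutative semigroup laws a term over \<open>x\<^sub>0\<close> is determined by its number of leaves, so
  \<open>e\<close> presents the quotient of the positive integers by a congruence, and an isomorphism between two
  such quotients forces the congruences to be equal. A congruence is determined by the
  least code of a pair \<open>(a, d)\<close> with \<open>d > 0\<close> and \<open>a\<close> congruent to \<open>a + d\<close>, if there is any; the set of these
  codes is uniformly c.e., which reduces isomorphism to \<open>E_min\<close>.
  Conversely, identifying the powers of \<open>x\<^sub>0\<close> with exponents \<open>n + 1\<close> and \<open>n + 2\<close> for all \<open>n\<close> in \<open>W e\<close> gives a
  congruence that remembers exactly the minimum of \<open>W e\<close>.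
\<close>

section \<open>Computable functions and decidable predicates\<close>

abbreviation pi1 :: "nat \<Rightarrow> nat" where "pi1 z \<equiv> fst (prod_decode z)"
abbreviation pi2 :: "nat \<Rightarrow> nat" where "pi2 z \<equiv> snd (prod_decode z)"

definition decidable :: "(nat \<Rightarrow> bool) \<Rightarrow> bool" where
  "decidable P \<longleftrightarrow> computable (\<lambda>x. of_bool (P x))"

lemma computableI: "(\<And>x. run p x = Some (h x)) \<Longrightarrow> computable h"
  unfolding computable_def by blast

lemma computable_id: "computable (\<lambda>x. x)"
  by (rule computableI[of "Tuple Fst Snd"]) simp

lemma computable_compose:
  assumes "computable g" "computable f"
  shows "computable (\<lambda>x. g (f x))"
proof -
  obtain p q where "\<And>x. run p x = Some (g x)" "\<And>x. run q x = Some (f x)"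
    using assms unfolding computable_def by blast
  then show ?thesis by (intro computableI[of "Comp p q"]) simp
qed

lemma computable_pair:
  assumes "computable f" "computable g"
  shows "computable (\<lambda>x. prod_encode (f x, g x))"
proof -
  obtain p q where "\<And>x. run p x = Some (f x)" "\<And>x. run q x = Some (g x)"
    using assms unfolding computable_def by blast
  then show ?thesis by (intro computableI[of "Tuple p q"]) simp
qed

lemma computable_Suc: "computable f \<Longrightarrow> computable (\<lambda>x. Suc (f x))"
  by (rule computable_compose[of Suc]) (rule computableI[of Succ], simp)

lemma computable_pi1: "computable f \<Longrightarrow> computable (\<lambda>x. pi1 (f x))"
  by (rule computable_compose[of pi1]) (rule computableI[of Fst], simp)

lemma computable_pi2: "computable f \<Longrightarrow> computable (\<lambda>x. pi2 (f x))"
  by (rule computable_compose[of pi2]) (rule computableI[of Snd], simp)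

primrec const_prog :: "nat \<Rightarrow> recf" where
  "const_prog 0 = Zero"
| "const_prog (Suc n) = Comp Succ (const_prog n)"

lemma run_const_prog: "run (const_prog n) x = Some n"
  by (induction n) auto

lemma computable_const: "computable (\<lambda>x. n)"
  by (rule computableI[of "const_prog n"]) (rule run_const_prog)

text \<open>The parameter passed to \<open>Prec\<close> is the whole input \<open>x\<close>, so the
  start value, the step function and the recursion depth may all depend on it.\<close>

lemma computable_rec:
  assumes "computable f" "computable (\<lambda>z. G (pi1 z) (pi1 (pi2 z)) (pi2 (pi2 z)))" "computable n"
  shows "computable (\<lambda>x. rec_nat (f x) (G x) (n x))"
proof -
  obtain p q r where *: "\<And>x. run p x = Some (f x)" "\<And>x. run r x = Some (n x)"
    and q: "\<And>z. run q z = Some (G (pi1 z) (pi1 (pi2 z)) (pi2 (pi2 z)))"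
    using assms unfolding computable_def by metis
  have "rec_nat (Some (f x)) (\<lambda>m r. Option.bind r (\<lambda>y. run q (prod_encode (x, prod_encode (m, y))))) k
      = Some (rec_nat (f x) (G x) k)" for x k
    by (induction k) (auto simp: q)
  then show ?thesis
    by (intro computableI[of "Comp (Prec p q) (Tuple (Tuple Fst Snd) r)"]) (simp add: *)
qed

lemmas computable_basic =
  computable_const computable_id computable_Suc computable_pi1 computable_pi2 computable_pair

lemma computable_add:
  assumes "computable f" "computable g"
  shows "computable (\<lambda>x. f x + g x)"
proof -
  have "rec_nat a (\<lambda>_ r. Suc r) b = a + b" for a b :: nat by (induction b) auto
  moreover have "computable (\<lambda>x. rec_nat (f x) (\<lambda>_ r. Suc r) (g x))"
    by (intro computable_rec computable_basic assms)
  ultimately show ?thesis by simp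
qed

lemma computable_mult:
  assumes "computable f" "computable g"
  shows "computable (\<lambda>x. f x * g x)"
proof -
  have "rec_nat 0 (\<lambda>_ r. r + a) b = a * b" for a b :: nat by (induction b) auto
  moreover have "computable (\<lambda>x. rec_nat 0 (\<lambda>_ r. r + f x) (g x))"
    by (intro computable_rec computable_add computable_basic assms
        computable_compose[OF assms(1) computable_pi1])
  ultimately show ?thesis by simp
qed

lemma computable_diff:
  assumes "computable f" "computable g"
  shows "computable (\<lambda>x. f x - g x)"
proof -
  have pred: "rec_nat 0 (\<lambda>m _. m) b = b - 1" for b by (cases b) auto
  have "computable (\<lambda>x. rec_nat 0 (\<lambda>m _. m) x)"
    by (intro computable_rec computable_basic)
  then have pred: "computable (\<lambda>x. x - 1)" by (simp add: pred)
  have "computable (\<lambda>x. rec_nat (f x) (\<lambda>_ r. r - 1) (g x))"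
    by (intro computable_rec computable_basic computable_compose[OF pred] assms)
  moreover have "rec_nat a (\<lambda>_ r. r - 1) b = a - b" for a b :: nat by (induction b) auto
  ultimately show ?thesis by simp
qed

section \<open>Closure properties of decidable predicates\<close>

lemma decidable_compose: "decidable P \<Longrightarrow> computable f \<Longrightarrow> decidable (\<lambda>x. P (f x))"
  unfolding decidable_def by (rule computable_compose[of "\<lambda>x. of_bool (P x)"])

lemma decidable_not:
  assumes "decidable P"
  shows "decidable (\<lambda>x. \<not> P x)"
proof -
  have "computable (\<lambda>x. 1 - of_bool (P x))"
    using assms unfolding decidable_def by (intro computable_diff computable_const)
  moreover have "1 - of_bool b = (of_bool (\<not> b) :: nat)" for b by simp
  ultimately show ?thesis by (simp only: decidable_def)
qed

lemma decidable_conj: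
  assumes "decidable P" "decidable Q"
  shows "decidable (\<lambda>x. P x \<and> Q x)"
  using computable_mult[OF assms[unfolded decidable_def]] by (simp only: decidable_def of_bool_conj)

lemma decidable_disj:
  assumes "decidable P" "decidable Q"
  shows "decidable (\<lambda>x. P x \<or> Q x)"
proof -
  have "decidable (\<lambda>x. \<not> (\<not> P x \<and> \<not> Q x))"
    by (intro decidable_not decidable_conj assms)
  then show ?thesis by simp
qed

lemma decidable_imp:
  assumes "decidable P" "decidable Q"
  shows "decidable (\<lambda>x. P x \<longrightarrow> Q x)"
  unfolding imp_conv_disj by (intro decidable_disj decidable_not assms)

lemma decidable_eq:
  assumes "computable f" "computable g"
  shows "decidable (\<lambda>x. f x = g x)"
proof -
  have "computable (\<lambda>x. 1 - ((f x - g x) + (g x - f x)))"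
    by (intro computable_diff computable_add computable_const assms)
  \<comment> \<open>Subtraction is truncated, so the two differences vanish together only for
    \<open>a = b\<close>.\<close>
  moreover have "1 - ((a - b) + (b - a)) = of_bool (a = b)" for a b :: nat by auto
  ultimately show ?thesis by (simp add: decidable_def)
qed

lemma decidable_less:
  assumes "computable f" "computable g"
  shows "decidable (\<lambda>x. f x < g x)"
proof -
  have "decidable (\<lambda>x. \<not> g x - f x = 0)"
    by (intro decidable_not decidable_eq computable_diff computable_const assms)
  then show ?thesis by (simp add: not_le)
qed

text \<open>A recursion up to \<open>b x\<close> accumulates the disjunction. The range is written
  as \<open>{..<b x}\<close> so that the lemma applies to the certificate rules once
  \<open>D\<close> is an initial segment.\<close>

lemma decidable_bex:
  assumes "computable b" "decidable (\<lambda>z. Q (pi1 z) (pi2 z))"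
  shows "decidable (\<lambda>x. \<exists>y\<in>{..<b x}. Q x y)"
proof -
  define G where "G x m r = (of_bool (r = 1 \<or> Q x m) :: nat)" for x m and r :: nat
  have Q: "decidable (\<lambda>z. Q (f z) (g z))" if "computable f" "computable g" for f g
    using decidable_compose[OF assms(2) computable_pair[OF that]] by simp
  have "rec_nat 0 (G x) n = of_bool (\<exists>y\<in>{..<n}. Q x y)" for x n
    by (induction n) (auto simp: G_def lessThan_Suc)
  moreover have "computable (\<lambda>z. G (pi1 z) (pi1 (pi2 z)) (pi2 (pi2 z)))"
    unfolding G_def decidable_def[symmetric]
    by (intro decidable_disj decidable_eq Q computable_basic)
  then have "computable (\<lambda>x. rec_nat 0 (G x) (b x))"
    using assms(1) by (intro computable_rec computable_const)
  ultimately show ?thesis by (simp add: decidable_def)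
qed

lemma decidable_ball:
  assumes "computable b" "decidable (\<lambda>z. Q (pi1 z) (pi2 z))"
  shows "decidable (\<lambda>x. \<forall>y\<in>{..<b x}. Q x y)"
  proof -
  have "decidable (\<lambda>x. \<not> (\<exists>y\<in>{..<b x}. \<not> Q x y))"
    by (intro decidable_not decidable_bex assms)
  then show ?thesis by simp
qed

text \<open>Parity flips at each step, and the quotient grows exactly when the counter is
  odd.\<close>

lemma computable_div2: "computable (\<lambda>x. x div 2)"
proof -
  have "rec_nat 0 (\<lambda>_ r. 1 - r) n = n mod 2" for n :: nat
    by (induction n) (simp_all add: mod_Suc)
  moreover have "computable (\<lambda>x. rec_nat 0 (\<lambda>_ r. 1 - r) x)"
    by (intro computable_rec computable_diff computable_basic)
  ultimately have mod2: "computable (\<lambda>x. x mod 2)" by simp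
  have "m div 2 + m mod 2 = Suc m div 2" for m :: nat by presburger
  then have "rec_nat 0 (\<lambda>m r. r + m mod 2) n = n div 2" for n :: nat by (induction n) simp_all
  moreover have "computable (\<lambda>x. rec_nat 0 (\<lambda>m r. r + m mod 2) x)"
    by (intro computable_rec computable_add computable_compose[OF mod2] computable_basic)
  ultimately show ?thesis by simp
qed

text \<open>Iterated halving exposes the binary digit to be tested. This makes finite sets of
  judgements usable as search witnesses.\<close>

lemma decidable_set_decode:
  assumes "computable f" "computable s"
  shows "decidable (\<lambda>x. f x \<in> set_decode (s x))"
proof -
  have div: "rec_nat a (\<lambda>_ r. r div 2) n = a div 2 ^ n" for a n :: nat
    by (induction n) (simp_all add: div_mult2_eq power_Suc2 del: power_Suc)
  have "computable (\<lambda>x. rec_nat (s x) (\<lambda>_ r. r div 2) (f x))"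
    by (intro computable_rec computable_compose[OF computable_div2] computable_basic assms)
  then have *: "computable (\<lambda>x. s x div 2 ^ f x)" by (simp add: div)
  have "decidable (\<lambda>x. \<not> s x div 2 ^ f x = 2 * (s x div 2 ^ f x div 2))"
    by (intro decidable_not decidable_eq computable_mult computable_compose[OF computable_div2]
        computable_const *)
  moreover have "odd n \<longleftrightarrow> \<not> n = 2 * (n div 2)" for n :: nat
    by (metis dvd_mult_div_cancel dvd_triv_left)
  ultimately show ?thesis by (simp only: set_decode_def mem_Collect_eq)
qed

lemmas computable_intros = computable_basic computable_add computable_mult
  decidable_not decidable_conj decidable_disj decidable_imp decidable_eq decidable_less
  decidable_bex decidable_ball decidable_set_decode

section \<open>Unbounded search and uniformly c.e. sets\<close>

text \<open>At most one number satisfies the condition, since the smaller of two would have to yield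
  both zero and a positive value. This eliminates \<open>LEAST\<close>.\<close>

lemma run_Mu_iff:
  "run (Mu f) x = Some y \<longleftrightarrow> run f (prod_encode (x, y)) = Some 0 \<and>
     (\<forall>m<y. \<exists>k. run f (prod_encode (x, m)) = Some (Suc k))" (is "_ \<longleftrightarrow> ?P y")
proof -
  have least: "(LEAST n. ?P n) = n" if "?P n" for n
  proof (rule Least_equality[where P = ?P])
    show "?P n" by (rule that)
    show "n \<le> m" if "?P m" for m
      using that \<open>?P n\<close> by (metis Zero_not_Suc not_le option.inject)
  qed
  have run: "run (Mu f) x = Some n" if "?P n" for n
  proof -
    have ex: "\<exists>n. ?P n" using that by (rule exI)
    show ?thesis unfolding run.simps Let_def if_P[OF ex] least[OF that] ..
  qed
  show ?thesis
  proof
    assume r: "run (Mu f) x = Some y"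
    have "\<exists>n. ?P n"
    proof (rule ccontr)
      assume no: "\<not> (\<exists>n. ?P n)"
      have "run (Mu f) x = None" unfolding run.simps Let_def if_not_P[OF no] ..
      then show False using r by simp
    qed
    then obtain n where n: "?P n" ..
    have "n = y" using run[OF n] r by (simp only: option.inject)
    then show "?P y" using n by blast
  qed (rule run)
qed

text \<open>\<open>Mu\<close> looks for the value 0, hence it is applied to the characteristic
  function of the negation.\<close>

lemma search_prog:
  assumes "decidable (\<lambda>z. Q (pi1 z) (pi2 z))"
  obtains p where "\<And>x w. run p x = Some w \<longleftrightarrow> Q x w \<and> (\<forall>v<w. \<not> Q x v)"
proof -
  obtain q where q: "\<And>z. run q z = Some (of_bool (\<not> Q (pi1 z) (pi2 z)))"
    using decidable_not[OF assms] unfolding decidable_def computable_def by blast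
  have "run (Mu q) x = Some w \<longleftrightarrow> Q x w \<and> (\<forall>v<w. \<not> Q x v)" for x w
    unfolding run_Mu_iff by (auto simp: q)
  then show ?thesis by (rule that)
qed

lemma W_goedel: "W (goedel p) = dom (run p)"
  by (simp add: W_def inv_f_f[OF inj_goedel])

text \<open>As in the s-m-n theorem, the parameter is hard-wired into one fixed search program
  through a constant program.\<close>

lemma uniformly_ce:
  assumes "decidable (\<lambda>z. Q (pi1 (pi1 z)) (pi2 (pi1 z)) (pi2 z))"
  obtains h where "computable h" "\<And>e. W (h e) = {x. \<exists>w. Q e x w}"
proof -
  obtain p where "\<And>z w. run p z = Some w \<longleftrightarrow> Q (pi1 z) (pi2 z) w \<and> (\<forall>v<w. \<not> Q (pi1 z) (pi2 z) v)"
    using assms by (rule search_prog[where Q = "\<lambda>z. Q (pi1 z) (pi2 z)"]) blast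
  then have p: "(\<exists>w. run p z = Some w) \<longleftrightarrow> (\<exists>w. Q (pi1 z) (pi2 z) w)" for z
    using exists_least_iff[of "Q (pi1 z) (pi2 z)"] by blast
  define h where "h e = goedel (Comp p (Tuple (const_prog e) (Tuple Fst Snd)))" for e
  \<comment> \<open>Each further composition with \<open>Succ\<close>, whose code is 1, wraps the
    previous code in one more layer.\<close>
  have "goedel (const_prog e) = rec_nat 0 (\<lambda>_ r. 5 + 4 * prod_encode (1, r)) e" for e
    by (induction e) auto
  moreover have "computable (\<lambda>e. rec_nat 0 (\<lambda>_ r. 5 + 4 * prod_encode (1, r)) e)"
    by (intro computable_rec computable_intros)
  ultimately have "computable (\<lambda>e. goedel (const_prog e))" by simp
  then have "computable h" unfolding h_def goedel.simps by (intro computable_intros)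
  moreover have "W (h e) = {x. \<exists>w. Q e x w}" for e
    unfolding h_def W_goedel by (auto simp: p run_const_prog dom_def)
  ultimately show ?thesis by (rule that)
qed

section \<open>Terms modulo the commutative semigroup laws\<close>

primrec leaves :: "trm \<Rightarrow> nat" where
  "leaves X0 = 1"
| "leaves (Mul s t) = leaves s + leaves t"

text \<open>The exponents are shifted: \<open>pw n\<close> has \<open>n + 1\<close> leaves.\<close>

primrec pw :: "nat \<Rightarrow> trm" where
  "pw 0 = X0"
| "pw (Suc n) = Mul X0 (pw n)"

lemma leaves_pos: "0 < leaves s"
  by (induction s) auto

lemma leaves_pw [simp]: "leaves (pw n) = Suc n"
  by (induction n) auto

section \<open>The congruence induced on exponents\<close>

text \<open>One use of a generating pair inside a power of the generator; \<open>x\<close> counts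
  the remaining factors and is 0 when the pair is the whole term.\<close>

definition step :: "(trm \<times> trm \<Rightarrow> nat) \<Rightarrow> nat \<Rightarrow> nat \<Rightarrow> nat \<Rightarrow> bool" where
  "step c e a b \<longleftrightarrow> (\<exists>s t x. c (s, t) \<in> W e \<and>
     (a = leaves s + x \<and> b = leaves t + x \<or> a = leaves t + x \<and> b = leaves s + x))"

definition ncong :: "(trm \<times> trm \<Rightarrow> nat) \<Rightarrow> nat \<Rightarrow> nat \<Rightarrow> nat \<Rightarrow> bool" where
  "ncong c e = (step c e)\<^sup>*\<^sup>*"

text \<open>These are the congruences of the additive monoid of natural numbers; by commutativity,
  translation on one side gives compatibility with addition.\<close>

definition additive :: "(nat \<Rightarrow> nat \<Rightarrow> bool) \<Rightarrow> bool" where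
  "additive N \<longleftrightarrow> equivp N \<and> (\<forall>a b x. N a b \<longrightarrow> N (a + x) (b + x))"

lemma additiveD:
  assumes "additive N"
  shows additive_refl: "N a a"
    and additive_sym: "N a b \<Longrightarrow> N b a"
    and additive_trans: "N a b \<Longrightarrow> N b d \<Longrightarrow> N a d"
    and additive_shift: "N a b \<Longrightarrow> N (a + x) (b + x)"
proof -
  have N: "equivp N" using assms by (simp add: additive_def)
  show "N a a" "N a b \<Longrightarrow> N b a" "N a b \<Longrightarrow> N b d \<Longrightarrow> N a d"
    by (rule equivp_reflp[OF N]) (blast intro: equivp_symp[OF N] equivp_transp[OF N])+
  show "N a b \<Longrightarrow> N (a + x) (b + x)" using assms by (simp add: additive_def)
qed

lemma additive_add:
  assumes "additive N" "N a b" "N a' b'"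
  shows "N (a + a') (b + b')"
proof (rule additiveD(3)[OF assms(1)])
  show "N (a + a') (b + a')" using assms(1,2) by (rule additiveD(4))
  show "N (b + a') (b + b')" using additiveD(4)[OF assms(1,3), of b] by (simp add: add.commute)
qed

lemma additive_mult:
  assumes "additive N" "N a b"
  shows "N (k * a) (k * b)"
  by (induction k) (simp_all add: additiveD(1)[OF assms(1)] additive_add[OF assms(1)] assms(2))

lemma step_shift: "step c e a b \<Longrightarrow> step c e (a + x) (b + x)"
  unfolding step_def by (metis add.assoc)

lemma additive_ncong: "additive (ncong c e)"
proof -
  have "symp (step c e)"
    unfolding symp_def step_def by blast
  then have "symp (ncong c e)"
    unfolding ncong_def by (rule symp_rtranclp)
  then have "equivp (ncong c e)"
    by (auto simp: equivp_reflp_symp_transp ncong_def reflp_def transp_def)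
  moreover have "ncong c e (a + x) (b + x)" if "ncong c e a b" for a b x
    using that unfolding ncong_def
    by (induction rule: rtranclp_induct) (auto intro: rtranclp.rtrancl_into_rtrancl step_shift)
  ultimately show ?thesis unfolding additive_def by blast
qed

lemma ncong_generator: "c (s, t) \<in> W e \<Longrightarrow> ncong c e (leaves s) (leaves t)"
  unfolding ncong_def step_def by (intro r_into_rtranclp) (metis add_0_right)

text \<open>Each step is a translate of a generating pair or of its converse. The lemma bounds
  \<open>ncong\<close> from above by explicit additive relations.\<close>

lemma ncong_minimal:
  assumes "additive N" "\<And>s t. c (s, t) \<in> W e \<Longrightarrow> N (leaves s) (leaves t)" "ncong c e a b"
  shows "N a b"
  using assms(3) unfolding ncong_def
proof (induction rule: rtranclp_induct)
  case base
  show ?case by (rule additiveD(1)[OF assms(1)])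
next
  case (step a' b)
  then have "N a' b"
    unfolding step_def by (auto intro: additiveD(2,4)[OF assms(1)] assms(2))
  with step.IH show ?case by (rule additiveD(3)[OF assms(1)])
qed

lemma congruenceD:
  assumes "congruence R"
  shows "(s, s) \<in> R" "(s, t) \<in> R \<Longrightarrow> (t, s) \<in> R"
    "(s, t) \<in> R \<Longrightarrow> (t, u) \<in> R \<Longrightarrow> (s, u) \<in> R"
    "(s, s') \<in> R \<Longrightarrow> (t, t') \<in> R \<Longrightarrow> (Mul s t, Mul s' t') \<in> R"
proof -
  have R: "refl R" "sym R" "trans R"
    using assms by (auto simp: congruence_def equiv_def)
  show "(s, s) \<in> R" using R(1) by (simp add: refl_on_def)
  show "(s, t) \<in> R \<Longrightarrow> (t, s) \<in> R" using R(2) by (rule symD)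
  show "(s, t) \<in> R \<Longrightarrow> (t, u) \<in> R \<Longrightarrow> (s, u) \<in> R" using R(3) by (rule transD)
  show "(s, s') \<in> R \<Longrightarrow> (t, t') \<in> R \<Longrightarrow> (Mul s t, Mul s' t') \<in> R"
    using assms by (simp add: congruence_def)
qed

text \<open>Associativity merges two right-nested powers into one, by induction on the left
  factor.\<close>

lemma normal_form:
  assumes "congruence R" "CS_laws \<subseteq> R"
  shows "(s, pw (leaves s - 1)) \<in> R"
proof (induction s)
  case X0
  show ?case by (simp add: congruenceD[OF assms(1)])
next
  case (Mul s t)
  have assoc: "(Mul (Mul r s) t, Mul r (Mul s t)) \<in> R" for r s t
    using assms(2) by (auto simp: CS_laws_def)
  have pw: "(Mul (pw a) (pw b), pw (Suc (a + b))) \<in> R" for a b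
  proof (induction a)
    case (Suc a)
    then have "(Mul X0 (Mul (pw a) (pw b)), Mul X0 (pw (Suc (a + b)))) \<in> R"
      by (intro congruenceD(1,4)[OF assms(1)])
    then show ?case
      using congruenceD(3)[OF assms(1) assoc[of X0 "pw a" "pw b"]] by simp
  qed (simp add: congruenceD[OF assms(1)])
  have "Suc (leaves s - 1 + (leaves t - 1)) = leaves (Mul s t) - 1"
    using leaves_pos[of s] leaves_pos[of t] by simp
  then show ?case
    using congruenceD(3)[OF assms(1) congruenceD(4)[OF assms(1) Mul] pw] by metis
qed

text \<open>Pulling \<open>ncong\<close> back along \<open>leaves\<close> gives one of the
  congruences being intersected. Conversely, each of these contains the image of a chain of steps on
  the normal forms.\<close>

lemma CS1_cong_iff: "(s, t) \<in> CS1_cong c e \<longleftrightarrow> ncong c e (leaves s) (leaves t)"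
proof
  let ?R = "{(s, t). ncong c e (leaves s) (leaves t)}"
  note add = additiveD[OF additive_ncong]
  have "congruence ?R"
    unfolding congruence_def
    by (auto intro!: equivI refl_onI symI transI intro: add additive_add[OF additive_ncong])
  moreover have "{p. c p \<in> W e} \<subseteq> ?R" "CS_laws \<subseteq> ?R"
    by (auto simp: CS_laws_def ac_simps intro: ncong_generator add(1))
  ultimately show "(s, t) \<in> CS1_cong c e \<Longrightarrow> ncong c e (leaves s) (leaves t)"
    unfolding CS1_cong_def by blast
next
  assume *: "ncong c e (leaves s) (leaves t)"
  show "(s, t) \<in> CS1_cong c e"
    unfolding CS1_cong_def
  proof safe
    fix R
    assume R: "congruence R" and gen: "{p. c p \<in> W e} \<subseteq> R" and laws: "CS_laws \<subseteq> R"
    note cong = congruenceD[OF R] and nf = normal_form[OF R laws]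
    \<comment> \<open>A context of \<open>Suc y\<close> factors is multiplication by
      \<open>pw y\<close>; the empty context is separate because no term has zero leaves.\<close>
    have gen': "(pw (leaves u + x - 1), pw (leaves v + x - 1)) \<in> R" if "c (u, v) \<in> W e" for u v x
    proof (cases x)
      case 0
      then show ?thesis using that gen nf cong(2,3) by (metis (mono_tags) CollectI add_0_right subsetD)
    next
      case (Suc y)
      have "(Mul u (pw y), Mul v (pw y)) \<in> R"
        using that gen by (intro cong(1,4)) auto
      moreover have "(Mul w (pw y), pw (leaves w + x - 1)) \<in> R" for w
        using nf[of "Mul w (pw y)"] by (simp add: Suc)
      ultimately show ?thesis by (meson cong(2,3))
    qed
    have "(pw (leaves s - 1), pw (leaves t - 1)) \<in> R"
      using * unfolding ncong_def
    proof (induction rule: rtranclp_induct)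
      case (step a b)
      then have "(pw (a - 1), pw (b - 1)) \<in> R"
        unfolding step_def using gen' cong(2) by blast
      with step.IH show ?case by (rule cong)
    qed (rule cong)
    then show "(s, t) \<in> R" using nf cong(2,3) by meson
  qed
qed

section \<open>Isomorphisms between one-generated quotients\<close>

text \<open>Represents on terms the homomorphism that sends the generator to the class of
  \<open>u\<close>.\<close>

primrec substX0 :: "trm \<Rightarrow> trm \<Rightarrow> trm" where
  "substX0 u X0 = u"
| "substX0 u (Mul s t) = Mul (substX0 u s) (substX0 u t)"

lemma leaves_substX0: "leaves (substX0 u s) = leaves u * leaves s"
  by (induction s) (auto simp: algebra_simps)

text \<open>Leaf counts are exactly the positive numbers, so only 0 needs care. It is related to
  itself alone, because isolating 0 and identifying everything else is an additive relation that
  contains the generators.\<close>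

lemma ncong_eqI:
  assumes "\<And>s t. ncong c e (leaves s) (leaves t) \<longleftrightarrow> ncong c i (leaves s) (leaves t)"
  shows "ncong c e = ncong c i"
proof (intro ext)
  fix a b
  have 0: "ncong c j a b \<longleftrightarrow> a = b" if "a = 0 \<or> b = 0" for j
  proof -
    have "additive (\<lambda>a b. a = b \<or> 0 < a \<and> 0 < b)"
      by (auto simp: additive_def intro!: equivpI reflpI sympI transpI)
    then have "ncong c j a b \<Longrightarrow> a = b \<or> 0 < a \<and> 0 < b"
      by (rule ncong_minimal) (auto simp: leaves_pos)
    then show ?thesis using that additiveD(1)[OF additive_ncong] by auto
  qed
  show "ncong c e a b = ncong c i a b"
  proof (cases "a = 0 \<or> b = 0")
    case True
    then show ?thesis using 0 by simp
  next
    case False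
    then show ?thesis using assms[of "pw (a - 1)" "pw (b - 1)"] by simp
  qed
qed

text \<open>An isomorphism sends the generator to the class of some \<open>x\<^sub>0\<^sup>k\<close>, which
  again generates, so that \<open>j * k\<close> is congruent to \<open>1\<close> for some \<open>j\<close>;
  multiplication by \<open>k\<close> is then injective modulo the congruence.\<close>

lemma CS1_iso_iff: "CS1_iso c e i \<longleftrightarrow> ncong c e = ncong c i"
proof
  assume "ncong c e = ncong c i"
  then have "CS1_cong c e = CS1_cong c i"
    by (auto simp: CS1_cong_iff)
  then have "CS1_carrier c e = CS1_carrier c i" "CS1_mult c e = CS1_mult c i"
    by (simp_all add: CS1_carrier_def CS1_mult_def fun_eq_iff)
  then show "CS1_iso c e i"
    unfolding CS1_iso_def by (intro exI[of _ id]) auto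
next
  let ?cl = "\<lambda>e s. CS1_cong c e `` {s}"
  have eqv: "equiv UNIV (CS1_cong c e)" for e
    using congruence_CS1_cong by (auto simp: congruence_def)
  have cl: "?cl e s = ?cl e t \<longleftrightarrow> ncong c e (leaves s) (leaves t)" for e s t
    using eq_equiv_class_iff[OF eqv] by (simp add: CS1_cong_iff)
  have car: "?cl e s \<in> CS1_carrier c e" for e s
    by (simp add: CS1_carrier_def quotientI)
  assume "CS1_iso c e i"
  then obtain f where bij: "bij_betw f (CS1_carrier c e) (CS1_carrier c i)"
    and hom: "\<And>A B. A \<in> CS1_carrier c e \<Longrightarrow> B \<in> CS1_carrier c e \<Longrightarrow>
      f (CS1_mult c e A B) = CS1_mult c i (f A) (f B)"
    unfolding CS1_iso_def by blast
  have "f (?cl e X0) \<in> CS1_carrier c i"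
    using bij car by (auto dest: bij_betwE)
  \<comment> \<open>\<open>leaves u\<close> is the factor \<open>k\<close> by which the isomorphism
    multiplies exponents.\<close>
  then obtain u where u: "f (?cl e X0) = ?cl i u"
    by (auto simp: CS1_carrier_def elim: quotientE)
  have f: "f (?cl e s) = ?cl i (substX0 u s)" for s
  proof (induction s)
    case (Mul s t)
    then show ?case using hom[OF car car, of s t] by (simp add: CS1_mult_class)
  qed (simp add: u)
  \<comment> \<open>Surjectivity gives a preimage of the generator; the leaf count of its
    representative \<open>v\<close> serves as \<open>j\<close>.\<close>
  have "?cl i X0 \<in> f ` CS1_carrier c e"
    using bij car by (auto simp: bij_betw_def)
  then obtain v where "?cl i X0 = f (?cl e v)"
    by (auto simp: CS1_carrier_def elim!: quotientE)
  then have "ncong c i (leaves v * leaves u) 1"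
    using f[of v] cl[of i "substX0 u v" X0] by (simp add: leaves_substX0 mult.commute)
  then have unit: "ncong c i (leaves v * (leaves u * a)) a" for a
    using additive_mult[OF additive_ncong, of c i _ _ a] by (metis mult.assoc mult.commute mult.right_neutral)
  have inj: "?cl e s = ?cl e t \<longleftrightarrow> f (?cl e s) = f (?cl e t)" for s t
    using bij car by (metis bij_betw_def inj_on_eq_iff)
  show "ncong c e = ncong c i"
  proof (rule ncong_eqI)
    fix s t
    have "ncong c e (leaves s) (leaves t) \<longleftrightarrow> ncong c i (leaves u * leaves s) (leaves u * leaves t)"
      using inj[of s t] by (simp add: f cl leaves_substX0)
    \<comment> \<open>Forwards, multiply by \<open>leaves v\<close> and remove the factors by
      \<open>unit\<close>; backwards, multiply by \<open>leaves u\<close>.\<close>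
    also have "\<dots> \<longleftrightarrow> ncong c i (leaves s) (leaves t)"
      by (meson additiveD(2,3)[OF additive_ncong] additive_mult[OF additive_ncong] unit)
    finally show "ncong c e (leaves s) (leaves t) \<longleftrightarrow> ncong c i (leaves s) (leaves t)" .
  qed
qed

section \<open>Index and period of an additive congruence\<close>

definition periods :: "(nat \<Rightarrow> nat \<Rightarrow> bool) \<Rightarrow> nat set" where
  "periods N = {prod_encode (a, d) | a d. 0 < d \<and> N a (a + d)}"

lemma prod_encode_mono: "a \<le> a' \<Longrightarrow> d \<le> d' \<Longrightarrow> prod_encode (a, d) \<le> prod_encode (a', d')"
  unfolding prod_encode_def triangle_def prod.case by (intro add_mono div_le_mono mult_le_mono) auto

text \<open>Translation carries the jump by \<open>d\<close> from \<open>a\<close> to every larger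
  number, and iteration yields all multiples of \<open>d\<close>.\<close>

lemma additive_period:
  assumes N: "additive N" and "N a (a + d)" "a \<le> x" "d dvd r"
  shows "N x (x + r)"
proof -
  have step: "N y (y + d)" if "a \<le> y" for y
    using additiveD(4)[OF N assms(2), of "y - a"] that by (simp add: add.commute)
  have "N x (x + d * k)" for k
  proof (induction k)
    case (Suc k)
    have "N (x + d * k) (x + d * Suc k)"
      using step[of "x + d * k"] \<open>a \<le> x\<close> by (simp add: ac_simps)
    with Suc show ?case by (rule additiveD(3)[OF N])
  qed (simp add: additiveD(1)[OF N])
  then show ?thesis using \<open>d dvd r\<close> by (auto elim: dvdE)
qed

text \<open>The least code is the pair of index and period, because \<^const>\<open>prod_encode\<close> is monotone
  in both arguments.\<close>

lemma additive_iff_Least: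
  assumes N: "additive N" and least: "prod_encode (a, d) = (LEAST n. n \<in> periods N)"
    and ne: "periods N \<noteq> {}" and "0 < r"
  shows "N x (x + r) \<longleftrightarrow> a \<le> x \<and> d dvd r"
proof
  have "prod_encode (a, d) \<in> periods N"
    unfolding least using ne by (auto intro: LeastI)
  then have ad: "0 < d" "N a (a + d)"
    by (auto simp: periods_def)
  have min: "prod_encode (a, d) \<le> prod_encode (x, r)" if "0 < r" "N x (x + r)" for x r
    unfolding least using that by (auto simp: periods_def intro!: Least_le)
  show "N x (x + r)" if "a \<le> x \<and> d dvd r"
    using additive_period[OF N ad(2)] that by blast
  assume Nx: "N x (x + r)"
  \<comment> \<open>The index \<open>p\<close> and then the least period \<open>q\<close> at
    \<open>p\<close> are minimised separately, and only afterwards compared with \<open>a\<close>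
    and \<open>d\<close>.\<close>
  define p where "p = (LEAST y. \<exists>q>0. N y (y + q))"
  define q where "q = (LEAST q. 0 < q \<and> N p (p + q))"
  have "\<exists>q>0. N p (p + q)"
    unfolding p_def by (rule LeastI[of "\<lambda>y. \<exists>q>0. N y (y + q)" a]) (use ad in blast)
  then have q: "0 < q" "N p (p + q)"
    unfolding q_def by (metis (mono_tags, lifting) LeastI)+
  have p_le: "p \<le> y" if "0 < k" "N y (y + k)" for y k
    unfolding p_def using that by (intro Least_le) blast
  have q_dvd: "q dvd k" if "0 < k" "N y (y + k)" for y k
  proof -
    have per: "N (p + z) (p + z + q * m)" for z m
      by (rule additive_period[OF N q(2)]) auto
    \<comment> \<open>As \<open>q\<close> is positive, \<open>p + q * y\<close> is not below
      \<open>y\<close>, so the jump by \<open>k\<close> can be translated there and then brought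
      down to \<open>p\<close>.\<close>
    have "y + (p + q * y - y) = p + q * y"
      using q(1) by (cases q) auto
    then have "N (p + q * y) (p + q * y + k)"
      using additiveD(4)[OF N that(2), of "p + q * y - y"] by (simp add: ac_simps)
    then have "N p (p + k)"
      using additiveD(3)[OF N per[of 0 y]] additiveD(3)[OF N _ additiveD(2)[OF N per[of k y]]]
      by (simp add: ac_simps)
    \<comment> \<open>Dropping multiples of \<open>q\<close> leaves a jump by the remainder, which
      must be 0 by minimality of \<open>q\<close>.\<close>
    moreover have "p + k = p + k mod q + q * (k div q)" by simp
    ultimately have "N p (p + k mod q)"
      using additiveD(3)[OF N _ additiveD(2)[OF N per[of "k mod q" "k div q"]]] by simp
    moreover have "\<not> (0 < k mod q \<and> N p (p + k mod q))"
      using not_less_Least[of "k mod q" "\<lambda>q. 0 < q \<and> N p (p + q)"] q(1)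
      by (metis mod_less_divisor q_def)
    ultimately show ?thesis by (simp add: dvd_eq_mod_eq_0)
  qed
  have "p \<le> a" "q \<le> d"
    using p_le[OF ad] dvd_imp_le[OF q_dvd[OF ad] ad(1)] .
  \<comment> \<open>Monotonicity gives one inequality between the codes, leastness of the code of
    \<open>(a, d)\<close> the other.\<close>
  then have "prod_encode (p, q) = prod_encode (a, d)"
    using min[OF q] prod_encode_mono by (intro order.antisym) auto
  then show "a \<le> x \<and> d dvd r"
    using p_le[OF \<open>0 < r\<close> Nx] q_dvd[OF \<open>0 < r\<close> Nx] by simp
qed

lemma additive_eqI:
  assumes "additive N" "additive N'"
    and "\<And>x r. 0 < r \<Longrightarrow> N x (x + r) \<longleftrightarrow> N' x (x + r)"
  shows "N = N'"
proof (intro ext)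
  have le: "N x y \<longleftrightarrow> N' x y" if "x \<le> y" for x y
    using assms(3)[of "y - x" x] that additiveD(1)[OF assms(1)] additiveD(1)[OF assms(2)]
    by (cases "x = y") auto
  fix x y
  show "N x y = N' x y"
    using le additiveD(2)[OF assms(1)] additiveD(2)[OF assms(2)] by (meson nle_le)
qed

text \<open>Equal least codes mean equal index and period; without any code both relations are
  equality. The right-hand side has the shape of \<open>E_min\<close>, with \<open>periods\<close>
  in place of \<open>W\<close>.\<close>

lemma additive_eq_iff_periods:
  assumes "additive N" "additive N'"
  shows "N = N' \<longleftrightarrow>
    periods N \<noteq> {} \<and> periods N' \<noteq> {} \<and> (LEAST n. n \<in> periods N) = (LEAST n. n \<in> periods N') \<or>
    periods N = {} \<and> periods N' = {}" (is "_ \<longleftrightarrow> ?ne \<or> ?empty")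
proof
  assume *: "?ne \<or> ?empty"
  obtain a d where ad: "prod_encode (a, d) = (LEAST n. n \<in> periods N)"
    by (metis prod_decode_inverse surj_pair)
  show "N = N'"
  proof (rule additive_eqI[OF assms])
    fix x r :: nat
    assume r: "0 < r"
    from * show "N x (x + r) \<longleftrightarrow> N' x (x + r)"
    proof
      assume ?empty
      then show ?thesis using r unfolding periods_def by blast
    next
      assume ?ne
      then have "prod_encode (a, d) = (LEAST n. n \<in> periods N')" "periods N \<noteq> {}" "periods N' \<noteq> {}"
        using ad by auto
      then show ?thesis
        using additive_iff_Least[OF assms(1) ad _ r] additive_iff_Least[OF assms(2) _ _ r] by simp
    qed
  qed
qed auto

section \<open>Certificates\<close>

text \<open>A computation, the size of a term or a chain of elementary steps is certified by a finite set
  of judgements, each of which follows from others in the set by a rule. Quantifiers in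
  the rules range over a finite set \<open>D\<close>, so that it is decidable whether a coded set is a certificate.
  No order on the judgements is needed, because the rules decrease the program, the recursion argument,
  the term or the length of the chain.\<close>

abbreviation Ev :: "nat \<Rightarrow> nat \<Rightarrow> nat \<Rightarrow> nat" where
  "Ev e x y \<equiv> prod_encode (0, prod_encode (e, prod_encode (x, y)))"
abbreviation Sz :: "nat \<Rightarrow> nat \<Rightarrow> nat" where
  "Sz u p \<equiv> prod_encode (2, prod_encode (u, p))"
abbreviation Ch :: "nat \<Rightarrow> nat \<Rightarrow> nat \<Rightarrow> nat" where
  "Ch a k b \<equiv> prod_encode (3, prod_encode (a, prod_encode (k, b)))"

text \<open>\<open>Ev e x y\<close> asserts that program \<open>e\<close> maps \<open>x\<close> to
  \<open>y\<close>, \<open>Sz u p\<close> that the term coded by \<open>u\<close> has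
  \<open>p\<close> leaves, \<open>Ch a k b\<close> that \<open>k\<close> steps lead from
  \<open>a\<close> to \<open>b\<close>. In all rules \<open>D\<close> is the range of the
  existential quantifiers and \<open>X\<close> supplies the premises.\<close>

definition tuple_rule :: "nat set \<Rightarrow> nat set \<Rightarrow> nat \<Rightarrow> nat \<Rightarrow> nat \<Rightarrow> bool" where
  "tuple_rule D X e x y \<longleftrightarrow> (\<exists>f\<in>D. \<exists>g\<in>D. \<exists>u\<in>D. \<exists>v\<in>D. e = 4 + 4 * prod_encode (f, g) \<and>
     Ev f x u \<in> X \<and> Ev g x v \<in> X \<and> y = prod_encode (u, v))"

definition comp_rule :: "nat set \<Rightarrow> nat set \<Rightarrow> nat \<Rightarrow> nat \<Rightarrow> nat \<Rightarrow> bool" where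
  "comp_rule D X e x y \<longleftrightarrow> (\<exists>f\<in>D. \<exists>g\<in>D. \<exists>u\<in>D. e = 5 + 4 * prod_encode (f, g) \<and>
     Ev g x u \<in> X \<and> Ev f u y \<in> X)"

definition prec_rule :: "nat set \<Rightarrow> nat set \<Rightarrow> nat \<Rightarrow> nat \<Rightarrow> nat \<Rightarrow> bool" where
  "prec_rule D X e x y \<longleftrightarrow> (\<exists>f\<in>D. \<exists>g\<in>D. e = 6 + 4 * prod_encode (f, g) \<and>
     (pi2 x = 0 \<and> Ev f (pi1 x) y \<in> X \<or>
      (\<exists>n\<in>D. \<exists>u\<in>D. pi2 x = Suc n \<and> Ev e (prod_encode (pi1 x, n)) u \<in> X \<and>
         Ev g (prod_encode (pi1 x, prod_encode (n, u))) y \<in> X)))"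

definition mu_rule :: "nat set \<Rightarrow> nat set \<Rightarrow> nat \<Rightarrow> nat \<Rightarrow> nat \<Rightarrow> bool" where
  "mu_rule D X e x y \<longleftrightarrow> (\<exists>f\<in>D. e = 7 + 4 * f \<and> Ev f (prod_encode (x, y)) 0 \<in> X \<and>
     (\<forall>m\<in>{..<y}. \<exists>k\<in>D. Ev f (prod_encode (x, m)) (Suc k) \<in> X))"

definition eval_rule :: "nat set \<Rightarrow> nat set \<Rightarrow> nat \<Rightarrow> nat \<Rightarrow> nat \<Rightarrow> bool" where
  "eval_rule D X e x y \<longleftrightarrow>
     e = 0 \<and> y = 0 \<or> e = 1 \<and> y = Suc x \<or> e = 2 \<and> y = pi1 x \<or> e = 3 \<and> y = pi2 x \<or>
     tuple_rule D X e x y \<or> comp_rule D X e x y \<or> prec_rule D X e x y \<or> mu_rule D X e x y"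

lemmas eval_rule_defs = eval_rule_def tuple_rule_def comp_rule_def prec_rule_def mu_rule_def

definition size_rule :: "nat set \<Rightarrow> nat set \<Rightarrow> nat \<Rightarrow> nat \<Rightarrow> bool" where
  "size_rule D X u p \<longleftrightarrow> u = 0 \<and> p = 1 \<or>
     (\<exists>v\<in>D. \<exists>w\<in>D. \<exists>q\<in>D. \<exists>r\<in>D. u = Suc (prod_encode (v, w)) \<and> p = q + r \<and> Sz v q \<in> X \<and> Sz w r \<in> X)"

text \<open>\<open>\<gamma>\<close> translates standard codes of pairs into codes under the given
  coding. A halting computation of \<open>e\<close>, with any output \<open>y\<close>, certifies
  membership in \<open>W e\<close>.\<close>

definition chain_rule :: "(nat \<Rightarrow> nat) \<Rightarrow> nat \<Rightarrow> nat set \<Rightarrow> nat set \<Rightarrow> nat \<Rightarrow> nat \<Rightarrow> nat \<Rightarrow> bool" where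
  "chain_rule \<gamma> e D X a k b \<longleftrightarrow> k = 0 \<and> a = b \<or>
     (\<exists>l\<in>D. \<exists>b'\<in>D. k = Suc l \<and> Ch a l b' \<in> X \<and>
        (\<exists>u\<in>D. \<exists>v\<in>D. \<exists>p\<in>D. \<exists>q\<in>D. \<exists>x\<in>D. \<exists>y\<in>D.
           Ev e (\<gamma> (prod_encode (u, v))) y \<in> X \<and> Sz u p \<in> X \<and> Sz v q \<in> X \<and>
           (b' = p + x \<and> b = q + x \<or> b' = q + x \<and> b = p + x)))"

definition rule :: "(nat \<Rightarrow> nat) \<Rightarrow> nat \<Rightarrow> nat set \<Rightarrow> nat set \<Rightarrow> nat \<Rightarrow> bool" where
  "rule \<gamma> e D X j \<longleftrightarrow>
     pi1 j = 0 \<and> eval_rule D X (pi1 (pi2 j)) (pi1 (pi2 (pi2 j))) (pi2 (pi2 (pi2 j))) \<or>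
     pi1 j = 2 \<and> size_rule D X (pi1 (pi2 j)) (pi2 (pi2 j)) \<or>
     pi1 j = 3 \<and> chain_rule \<gamma> e D X (pi1 (pi2 j)) (pi1 (pi2 (pi2 j))) (pi2 (pi2 (pi2 j)))"

definition certificate :: "(nat \<Rightarrow> nat) \<Rightarrow> nat \<Rightarrow> nat set \<Rightarrow> nat set \<Rightarrow> bool" where
  "certificate \<gamma> e D X \<longleftrightarrow> (\<forall>j\<in>X. rule \<gamma> e D X j)"

definition derivable :: "(nat \<Rightarrow> nat) \<Rightarrow> nat \<Rightarrow> nat \<Rightarrow> bool" where
  "derivable \<gamma> e j \<longleftrightarrow> (\<exists>D X. finite D \<and> finite X \<and> certificate \<gamma> e D X \<and> j \<in> X)"

lemma rule_simps:
  "rule \<gamma> e D X (Ev f x y) \<longleftrightarrow> eval_rule D X f x y"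
  "rule \<gamma> e D X (Sz u p) \<longleftrightarrow> size_rule D X u p"
  "rule \<gamma> e D X (Ch a k b) \<longleftrightarrow> chain_rule \<gamma> e D X a k b"
  by (simp_all add: rule_def)

text \<open>\<open>D\<close> and \<open>X\<close> occur only positively; the universal quantifier of
  \<open>mu_rule\<close> has its own range.\<close>

lemma rule_mono:
  assumes "rule \<gamma> e D X j" "D \<subseteq> D'" "X \<subseteq> X'"
  shows "rule \<gamma> e D' X' j"
proof -
  have bex: "(\<exists>x\<in>D. P x) \<longrightarrow> (\<exists>x\<in>D'. Q x)" if "\<And>x. P x \<longrightarrow> Q x" for P Q
    using assms(2) that by blast
  have ball: "(\<forall>x\<in>A. P x) \<longrightarrow> (\<forall>x\<in>A. Q x)" if "\<And>x. P x \<longrightarrow> Q x" for P Q and A :: "nat set"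
    using that by blast
  have "rule \<gamma> e D X j \<longrightarrow> rule \<gamma> e D' X' j"
    unfolding rule_def eval_rule_defs size_rule_def chain_rule_def
    by (intro imp_refl disj_mono conj_mono bex ball in_mono assms(3))
  then show ?thesis using assms(1) by blast
qed

lemma certificate_Un:
  assumes "certificate \<gamma> e D X" "certificate \<gamma> e D' X'"
  shows "certificate \<gamma> e (D \<union> D') (X \<union> X')"
proof -
  have "rule \<gamma> e (D \<union> D') (X \<union> X') j" if "j \<in> X" for j
    by (rule rule_mono[of _ _ D X]) (use assms(1) that in \<open>auto simp: certificate_def\<close>)
  moreover have "rule \<gamma> e (D \<union> D') (X \<union> X') j" if "j \<in> X'" for j
    by (rule rule_mono[of _ _ D' X']) (use assms(2) that in \<open>auto simp: certificate_def\<close>)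
  ultimately show ?thesis
    unfolding certificate_def by blast
qed

text \<open>Unions of certificates are certificates. Finite sets of premises are allowed because the
  number of premises of \<open>mu_rule\<close> depends on \<open>y\<close>.\<close>

lemma certificate_collect:
  assumes "finite J" "\<And>j. j \<in> J \<Longrightarrow> derivable \<gamma> e j"
  shows "\<exists>D X. finite D \<and> finite X \<and> certificate \<gamma> e D X \<and> J \<subseteq> X"
  using assms
proof (induction J)
  case empty
  show ?case by (intro exI[of _ "{}"]) (simp add: certificate_def)
next
  case (insert j J)
  then obtain D X D' X' where "finite D" "finite X" "certificate \<gamma> e D X" "J \<subseteq> X"
    "finite D'" "finite X'" "certificate \<gamma> e D' X'" "j \<in> X'"
    unfolding derivable_def by (metis insertCI)
  then show ?case
    by (intro exI[of _ "D \<union> D'"] exI[of _ "X \<union> X'"]) (auto intro: certificate_Un)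
qed

lemma derivable_rule:
  assumes "rule \<gamma> e D J j" "finite D" "finite J" "\<And>j. j \<in> J \<Longrightarrow> derivable \<gamma> e j"
  shows "derivable \<gamma> e j"
proof -
  obtain D' X where X: "finite D'" "finite X" "certificate \<gamma> e D' X" "J \<subseteq> X"
    using certificate_collect[OF assms(3,4)] by blast
  have "rule \<gamma> e (D \<union> D') (insert j X) j"
    by (rule rule_mono[OF assms(1)]) (use X in auto)
  moreover have "rule \<gamma> e (D \<union> D') (insert j X) i" if "i \<in> X" for i
    by (rule rule_mono[of _ _ D' X]) (use X that in \<open>auto simp: certificate_def\<close>)
  ultimately have "certificate \<gamma> e (D \<union> D') (insert j X)"
    unfolding certificate_def by blast
  then show ?thesis
    unfolding derivable_def using assms(2) X(1,2) by (intro exI[of _ "D \<union> D'"] exI[of _ "insert j X"]) auto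
qed

lemmas derivable_Ev = derivable_rule[OF rule_simps(1)[THEN iffD2]]
lemmas derivable_Sz = derivable_rule[OF rule_simps(2)[THEN iffD2]]
lemmas derivable_Ch = derivable_rule[OF rule_simps(3)[THEN iffD2]]

lemma eval_rule_base:
  "eval_rule D X 0 x 0" "eval_rule D X 1 x (Suc x)" "eval_rule D X 2 x (pi1 x)" "eval_rule D X 3 x (pi2 x)"
  by (simp_all add: eval_rule_def)

text \<open>The side conditions are inclusions so that \<open>order.refl\<close> can instantiate
  \<open>D\<close> and \<open>X\<close> with exactly the finite sets required; the later
  introduction rules follow this pattern.\<close>

lemma tuple_ruleI:
  "{f, g, u, v} \<subseteq> D \<Longrightarrow> {Ev f x u, Ev g x v} \<subseteq> X \<Longrightarrow>
    eval_rule D X (4 + 4 * prod_encode (f, g)) x (prod_encode (u, v))"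
  unfolding eval_rule_def tuple_rule_def insert_subset by blast

lemma comp_ruleI:
  "{f, g, u} \<subseteq> D \<Longrightarrow> {Ev g x u, Ev f u y} \<subseteq> X \<Longrightarrow> eval_rule D X (5 + 4 * prod_encode (f, g)) x y"
  unfolding eval_rule_def comp_rule_def insert_subset by blast

lemma prec_ruleI:
  "{f, g} \<subseteq> D \<Longrightarrow> {Ev f (pi1 x) y} \<subseteq> X \<Longrightarrow> pi2 x = 0 \<Longrightarrow>
    eval_rule D X (6 + 4 * prod_encode (f, g)) x y"
  "{f, g, n, u} \<subseteq> D \<Longrightarrow> {Ev (6 + 4 * prod_encode (f, g)) (prod_encode (pi1 x, n)) u,
      Ev g (prod_encode (pi1 x, prod_encode (n, u))) y} \<subseteq> X \<Longrightarrow> pi2 x = Suc n \<Longrightarrow>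
    eval_rule D X (6 + 4 * prod_encode (f, g)) x y"
  unfolding eval_rule_def prec_rule_def insert_subset by blast+

lemma mu_ruleI:
  "{f} \<union> k ` {..<y} \<subseteq> D \<Longrightarrow>
    {Ev f (prod_encode (x, y)) 0} \<union> (\<lambda>m. Ev f (prod_encode (x, m)) (Suc (k m))) ` {..<y} \<subseteq> X \<Longrightarrow>
    eval_rule D X (7 + 4 * f) x y"
  unfolding eval_rule_def mu_rule_def insert_subset Un_subset_iff image_subset_iff by blast

lemma size_rule_intros:
  "size_rule D X 0 1"
  "{v, w, q, r} \<subseteq> D \<Longrightarrow> {Sz v q, Sz w r} \<subseteq> X \<Longrightarrow> size_rule D X (Suc (prod_encode (v, w))) (q + r)"
  unfolding size_rule_def insert_subset by blast+

lemma chain_rule_intros: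
  "chain_rule \<gamma> e D X a 0 a"
  "{l, b', u, v, p, q, x, y} \<subseteq> D \<Longrightarrow>
    {Ch a l b', Ev e (\<gamma> (prod_encode (u, v))) y, Sz u p, Sz v q} \<subseteq> X \<Longrightarrow>
    b' = p + x \<and> b = q + x \<or> b' = q + x \<and> b = p + x \<Longrightarrow> chain_rule \<gamma> e D X a (Suc l) b"
  unfolding chain_rule_def insert_subset by blast+

section \<open>Completeness of certificates\<close>

lemma derivable_eval: "run p x = Some y \<Longrightarrow> derivable \<gamma> e (Ev (goedel p) x y)"
proof (induction p arbitrary: x y)
  case Zero
  then have "y = 0" by simp
  then show ?case
    unfolding goedel.simps using derivable_Ev[OF eval_rule_base(1)] by blast
next
  case Succ
  then have "y = Suc x" by simp
  then show ?case
    unfolding goedel.simps using derivable_Ev[OF eval_rule_base(2)] by blast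
next
  case Fst
  then have "y = pi1 x" by simp
  then show ?case
    unfolding goedel.simps using derivable_Ev[OF eval_rule_base(3)] by blast
next
  case Snd
  then have "y = pi2 x" by simp
  then show ?case
    unfolding goedel.simps using derivable_Ev[OF eval_rule_base(4)] by blast
next
  case (Tuple f g)
  then obtain u v where uv: "run f x = Some u" "run g x = Some v" and y: "y = prod_encode (u, v)"
    by (auto simp: bind_eq_Some_conv)
  show ?case
    unfolding goedel.simps y
    by (rule derivable_Ev[OF tuple_ruleI[OF order.refl order.refl]]) (use uv Tuple.IH in auto)
next
  case (Comp f g)
  then obtain u where u: "run g x = Some u" "run f u = Some y"
    by (auto simp: bind_eq_Some_conv)
  show ?case
    unfolding goedel.simps
    by (rule derivable_Ev[OF comp_ruleI[OF order.refl order.refl]]) (use u Comp.IH in auto)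
next
  case (Prec f g)
  \<comment> \<open>One premise of the recursive case is about the same program, hence an inner
    induction on the recursion argument.\<close>
  have "derivable \<gamma> e (Ev (6 + 4 * prod_encode (goedel f, goedel g)) (prod_encode (a, n)) y)"
    if "run (Prec f g) (prod_encode (a, n)) = Some y" for a n y
    using that
  proof (induction n arbitrary: y)
    case 0
    then have "run f a = Some y" by simp
    then show ?case
      by (intro derivable_Ev[OF prec_ruleI(1)[OF order.refl order.refl]]) (auto intro: Prec.IH)
  next
    case (Suc n)
    then obtain u where u: "run (Prec f g) (prod_encode (a, n)) = Some u"
      "run g (prod_encode (a, prod_encode (n, u))) = Some y"
      by (auto simp: bind_eq_Some_conv)
    show ?case
      by (rule derivable_Ev[OF prec_ruleI(2)[OF order.refl order.refl]])
        (use Suc.IH[OF u(1)] Prec.IH(2)[OF u(2)] in auto)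
  qed
  from this[of "pi1 x" "pi2 x"] show ?case
    unfolding goedel.simps using Prec.prems by simp
next
  case (Mu f)
  then obtain k where k: "run f (prod_encode (x, y)) = Some 0"
    "\<And>m. m < y \<Longrightarrow> run f (prod_encode (x, m)) = Some (Suc (k m))"
    unfolding run_Mu_iff by metis
  show ?case
    unfolding goedel.simps
    by (rule derivable_Ev[OF mu_ruleI[OF order.refl order.refl, of _ k]])
      (use Mu.IH[OF k(1)] Mu.IH[OF k(2)] in auto)
qed

lemma derivable_size: "derivable \<gamma> e (Sz (std_trm s) (leaves s))"
proof (induction s)
  case X0
  show ?case
    unfolding std_trm.simps leaves.simps using derivable_Sz[OF size_rule_intros(1)] by blast
next
  case (Mul s t)
  show ?case
    unfolding std_trm.simps leaves.simps
    by (rule derivable_Sz[OF size_rule_intros(2)[OF order.refl order.refl]]) (use Mul in auto)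
qed

lemma inv_std_coding: "inv std_coding (prod_encode (std_trm s, std_trm t)) = (s, t)"
  using bij_std_coding inv_f_f[of std_coding "(s, t)"] by (simp add: bij_def std_coding_def)

lemma derivable_chain:
  assumes "ncong c e a b"
  shows "\<exists>k. derivable (\<lambda>n. c (inv std_coding n)) e (Ch a k b)"
  using assms unfolding ncong_def
proof (induction rule: rtranclp_induct)
  case base
  show ?case
    using derivable_Ch[OF chain_rule_intros(1)] by blast
next
  case (step b' b)
  let ?\<gamma> = "\<lambda>n. c (inv std_coding n)"
  from step.IH obtain k where k: "derivable ?\<gamma> e (Ch a k b')" by blast
  from step.hyps obtain s t x where st: "c (s, t) \<in> W e"
    and b: "b' = leaves s + x \<and> b = leaves t + x \<or> b' = leaves t + x \<and> b = leaves s + x"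
    unfolding step_def by blast
  obtain y where "run (inv goedel e) (c (s, t)) = Some y"
    using st by (auto simp: W_def)
  from derivable_eval[OF this]
  have y: "derivable ?\<gamma> e (Ev e (?\<gamma> (prod_encode (std_trm s, std_trm t))) y)"
    by (simp add: surj_f_inv_f[OF surj_goedel] inv_std_coding)
  have "derivable ?\<gamma> e (Ch a (Suc k) b)"
    by (rule derivable_Ch[OF chain_rule_intros(2)[OF order.refl order.refl b]])
      (use k y derivable_size in blast)+
  then show ?case by blast
qed

section \<open>Soundness of certificates\<close>

lemma certificateD:
  assumes "certificate \<gamma> e D X"
  shows "Ev f x y \<in> X \<Longrightarrow> eval_rule D X f x y"
    and "Sz u p \<in> X \<Longrightarrow> size_rule D X u p"
    and "Ch a k b \<in> X \<Longrightarrow> chain_rule \<gamma> e D X a k b"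
  using assms unfolding certificate_def rule_simps[of \<gamma> e D X, symmetric] by blast+

text \<open>Induction on the program replaces induction on derivations: premises concern
  subprograms, or the same program at a smaller recursion argument.\<close>

lemma certificate_eval:
  assumes X: "certificate \<gamma> e D X"
  shows "Ev (goedel p) x y \<in> X \<Longrightarrow> run p x = Some y"
proof (induction p arbitrary: x y)
  \<comment> \<open>Residues modulo 4 separate the composite programs, so only the disjunct for the
    program at hand survives.\<close>
  have neq: "4 + 4 * a \<noteq> 5 + 4 * b" "4 + 4 * a \<noteq> 6 + 4 * b" "4 + 4 * a \<noteq> 7 + 4 * b"
    "5 + 4 * a \<noteq> 6 + 4 * b" "5 + 4 * a \<noteq> 7 + 4 * b" "6 + 4 * a \<noteq> 7 + 4 * b" for a b :: nat
    by presburger+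
  note neqs = neq neq[symmetric]
  note rule = certificateD(1)[OF X, unfolded eval_rule_defs]
  {
    case Zero
    from rule[OF this] show ?case by simp
  next
    case Succ
    from rule[OF this] show ?case by simp
  next
    case Fst
    from rule[OF this] show ?case by simp
  next
    case Snd
    from rule[OF this] show ?case by simp
  next
    case (Tuple f g)
    from rule[OF Tuple.prems] show ?case
      using Tuple.IH neqs by (auto simp del: add_Suc_right)
  next
    case (Comp f g)
    from rule[OF Comp.prems] show ?case
      using Comp.IH neqs by (auto simp del: add_Suc_right)
  next
    case (Prec f g)
    have "run (Prec f g) (prod_encode (a, n)) = Some y"
      if "Ev (goedel (Prec f g)) (prod_encode (a, n)) y \<in> X" for a n y
      using that
    proof (induction n arbitrary: y)
      case 0
      from rule[OF 0] show ?case
        using Prec.IH neqs by (auto simp del: add_Suc_right)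
    next
      case (Suc n)
      from rule[OF Suc.prems] show ?case
        using Suc.IH Prec.IH neqs by (auto simp del: add_Suc_right)
    qed
    from this[of "pi1 x" "pi2 x"] show ?case using Prec.prems by simp
  next
    case (Mu f)
    from rule[OF Mu.prems] have "Ev (goedel f) (prod_encode (x, y)) 0 \<in> X"
      "\<forall>m<y. \<exists>k. Ev (goedel f) (prod_encode (x, m)) (Suc k) \<in> X"
      using neqs by (auto simp del: add_Suc_right)
    then show ?case
      unfolding run_Mu_iff using Mu.IH by blast
  }
qed

lemma certificate_size:
  assumes X: "certificate \<gamma> e D X"
  shows "Sz (std_trm s) p \<in> X \<Longrightarrow> p = leaves s"
proof (induction s arbitrary: p)
  case X0
  from certificateD(2)[OF X X0] show ?case by (simp add: size_rule_def)
next
  case (Mul s t)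
  from certificateD(2)[OF X Mul.prems] show ?case
    using Mul.IH by (auto simp: size_rule_def)
qed

lemma certificate_chain:
  assumes X: "certificate (\<lambda>n. c (inv std_coding n)) e D X"
  shows "Ch a k b \<in> X \<Longrightarrow> ncong c e a b"
proof (induction k arbitrary: b)
  case 0
  from certificateD(3)[OF X 0] show ?case
    by (simp add: chain_rule_def ncong_def)
next
  case (Suc k)
  from certificateD(3)[OF X Suc.prems] obtain b' u v p q x y where
    b': "Ch a k b' \<in> X" and y: "Ev e (c (inv std_coding (prod_encode (u, v)))) y \<in> X"
    and pq: "Sz u p \<in> X" "Sz v q \<in> X" and b: "b' = p + x \<and> b = q + x \<or> b' = q + x \<and> b = p + x"
    unfolding chain_rule_def by blast
  \<comment> \<open>A certificate may mention arbitrary numbers, but each of them codes a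
    term.\<close>
  obtain s t where st: "u = std_trm s" "v = std_trm t"
    using surj_std_trm by (metis surjD)
  have "run (inv goedel e) (c (s, t)) = Some y"
    using certificate_eval[OF X, of "inv goedel e"] y
    by (simp add: surj_f_inv_f[OF surj_goedel] st inv_std_coding)
  then have "c (s, t) \<in> W e" by (auto simp: W_def)
  moreover have "p = leaves s" "q = leaves t"
    using pq certificate_size[OF X] unfolding st by blast+
  ultimately have "step c e b' b"
    using b unfolding step_def by blast
  with Suc.IH[OF b'] show ?case
    unfolding ncong_def by (rule rtranclp.rtrancl_into_rtrancl)
qed

section \<open>Deciding certificates for periods\<close>

text \<open>Makes quantification over the members of a coded set bounded by its code.\<close>

lemma set_decode_less: "j \<in> set_decode s \<Longrightarrow> j < s"
proof -
  assume "j \<in> set_decode s"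
  then have "2 ^ j \<le> s"
    by (auto simp: set_decode_def not_le[symmetric] intro: ccontr)
  then show ?thesis by (meson less_exp less_le_trans)
qed

text \<open>The witness \<open>w\<close> codes a bound, whose initial segment serves as
  \<open>D\<close> and contains the chain length, together with the finite set
  \<open>X\<close>.\<close>

definition check_period :: "(nat \<Rightarrow> nat) \<Rightarrow> nat \<Rightarrow> nat \<Rightarrow> nat \<Rightarrow> bool" where
  "check_period \<gamma> e z w \<longleftrightarrow> 0 < pi2 z \<and>
     (\<exists>k\<in>{..<pi1 w}. Ch (pi1 z) k (pi1 z + pi2 z) \<in> set_decode (pi2 w)) \<and>
     (\<forall>j\<in>{..<pi2 w}. j \<in> set_decode (pi2 w) \<longrightarrow> rule \<gamma> e {..<pi1 w} (set_decode (pi2 w)) j)"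

lemma periods_ncong:
  "periods (ncong c e) = {z. \<exists>w. check_period (\<lambda>n. c (inv std_coding n)) e z w}"
proof (intro set_eqI iffI)
  let ?\<gamma> = "\<lambda>n. c (inv std_coding n)"
  fix z
  assume "z \<in> periods (ncong c e)"
  then obtain a d where z: "z = prod_encode (a, d)" and d: "0 < d" and "ncong c e a (a + d)"
    by (auto simp: periods_def)
  from derivable_chain[OF this(3)] obtain k D X where
    X: "finite D" "finite X" "certificate ?\<gamma> e D X" "Ch a k (a + d) \<in> X"
    unfolding derivable_def by blast
  \<comment> \<open>The chain length joins \<open>D\<close> so that a single bound covers
    both.\<close>
  have "finite (insert k D)" using X(1) by simp
  then obtain B where "\<And>i. i \<in> insert k D \<Longrightarrow> i < B"
    unfolding finite_nat_set_iff_bounded by blast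
  then have B: "insert k D \<subseteq> {..<B}" by blast
  have "rule ?\<gamma> e {..<B} X j" if "j \<in> X" for j
    by (rule rule_mono[of _ _ D X]) (use X that B in \<open>auto simp: certificate_def\<close>)
  then have "check_period ?\<gamma> e z (prod_encode (B, set_encode X))"
    using B X(2,4) d by (auto simp: check_period_def z set_encode_inverse)
  then show "z \<in> {z. \<exists>w. check_period ?\<gamma> e z w}" by blast
next
  let ?\<gamma> = "\<lambda>n. c (inv std_coding n)"
  fix z
  assume "z \<in> {z. \<exists>w. check_period ?\<gamma> e z w}"
  then obtain w where w: "check_period ?\<gamma> e z w" by blast
  then have "certificate ?\<gamma> e {..<pi1 w} (set_decode (pi2 w))"
    unfolding check_period_def certificate_def by (auto dest: set_decode_less)
  with w have "0 < pi2 z" "ncong c e (pi1 z) (pi1 z + pi2 z)"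
    unfolding check_period_def by (auto dest: certificate_chain)
  moreover have "z = prod_encode (pi1 z, pi2 z)" by simp
  ultimately show "z \<in> periods (ncong c e)" unfolding periods_def by blast
qed

text \<open>All quantifiers are now bounded and all atoms are equations, inequalities or memberships
  in a decoded set.\<close>

lemma decidable_check_period:
  assumes \<gamma>: "computable \<gamma>"
  shows "decidable (\<lambda>z. check_period \<gamma> (pi1 (pi1 z)) (pi2 (pi1 z)) (pi2 z))"
  unfolding check_period_def rule_def eval_rule_defs size_rule_def chain_rule_def
  by (intro computable_intros computable_compose[OF \<gamma> computable_pair])

section \<open>The two reductions\<close>

lemma CS1_iso_reducible_E_min:
  assumes "computable_coding c"
  shows "CS1_iso c \<le>\<^sub>c E_min"
proof -
  have "computable (\<lambda>n. c (inv std_coding n))"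
    using assms by (simp add: computable_coding_def)
  from decidable_check_period[OF this] obtain h where h: "computable h"
    and W: "\<And>e. W (h e) = {z. \<exists>w. check_period (\<lambda>n. c (inv std_coding n)) e z w}"
    by (rule uniformly_ce[where Q = "check_period (\<lambda>n. c (inv std_coding n))"]) blast
  \<comment> \<open>By \<open>periods_ncong\<close>, the set \<open>W (h e)\<close> consists of the
    period codes of \<open>ncong c e\<close>.\<close>
  have "CS1_iso c e i \<longleftrightarrow> E_min (h e) (h i)" for e i
    unfolding E_min_def W CS1_iso_iff periods_ncong[symmetric]
    by (rule additive_eq_iff_periods[OF additive_ncong additive_ncong])
  with h show ?thesis unfolding reducible_def by blast
qed

text \<open>Each generating pair has leaf counts \<open>n + 1\<close> and \<open>n + 2\<close>, a
  jump by 1, and so collapses all exponents above \<open>n\<close>.\<close>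

lemma ncong_shifts_iff:
  assumes W: "{p. c p \<in> W e'} = (\<lambda>n. (pw n, pw (Suc n))) ` W e"
  shows "ncong c e' a b \<longleftrightarrow> a = b \<or> (\<exists>n\<in>W e. n < a \<and> n < b)"
proof
  let ?N = "\<lambda>a b. a = b \<or> (\<exists>n\<in>W e. n < a \<and> n < b)"
  have "equivp ?N"
  proof (rule equivpI)
    show "transp ?N"
      by (rule transpI) (metis not_less_iff_gr_or_eq order.strict_trans)
  qed (auto intro!: reflpI sympI)
  then have "additive ?N"
    unfolding additive_def by (blast intro: trans_less_add1)
  moreover have "?N (leaves s) (leaves t)" if "c (s, t) \<in> W e'" for s t
  proof -
    have "(s, t) \<in> (\<lambda>n. (pw n, pw (Suc n))) ` W e" using that W by blast
    then obtain n where "n \<in> W e" "s = pw n" "t = pw (Suc n)" by blast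
    then show ?thesis by (metis leaves_pw less_Suc_eq)
  qed
  ultimately show "ncong c e' a b \<Longrightarrow> ?N a b" by (rule ncong_minimal)
  have "ncong c e' x y" if "n \<in> W e" "n < x" "x \<le> y" for n x y
  proof -
    have "c (pw n, pw (Suc n)) \<in> W e'" using W that(1) by blast
    from ncong_generator[of c, OF this] have "ncong c e' (Suc n) (Suc n + 1)" by simp
    from additive_period[OF additive_ncong this, of x "y - x"] show ?thesis using that(2,3) by simp
  qed
  then show "?N a b \<Longrightarrow> ncong c e' a b"
    using additiveD(1,2)[OF additive_ncong] by (metis nle_le)
qed

text \<open>For a nonempty set the existential condition says that its minimum is below
  \<open>k\<close>, and a number is determined by the numbers above it.\<close>

lemma Least_eq_iff_upward:
  fixes A B :: "nat set"
  shows "(\<forall>k. (\<exists>n\<in>A. n < k) \<longleftrightarrow> (\<exists>n\<in>B. n < k)) \<longleftrightarrow>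
    A \<noteq> {} \<and> B \<noteq> {} \<and> (LEAST n. n \<in> A) = (LEAST n. n \<in> B) \<or> A = {} \<and> B = {}" (is "?L \<longleftrightarrow> ?R")
proof -
  have iff: "(\<exists>n\<in>C. n < k) \<longleftrightarrow> (LEAST n. n \<in> C) < k" if "C \<noteq> {}" for C and k :: nat
    using that by (meson LeastI_ex Least_le ex_in_conv le_less_trans)
  consider "A \<noteq> {}" "B \<noteq> {}" | "A = {}" | "B = {}" by blast
  then show ?thesis
  proof cases
    case 1
    have "?L \<longleftrightarrow> (\<forall>k. (LEAST n. n \<in> A) < k \<longleftrightarrow> (LEAST n. n \<in> B) < k)"
      unfolding iff[OF 1(1)] iff[OF 1(2)] ..
    also have "\<dots> \<longleftrightarrow> (LEAST n. n \<in> A) = (LEAST n. n \<in> B)"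
      by (metis nat_neq_iff)
    finally show ?thesis using 1 by simp
  qed (auto intro: lessI)
qed

lemma E_min_iff_ncong:
  assumes "\<And>e. {p. c p \<in> W (h e)} = (\<lambda>n. (pw n, pw (Suc n))) ` W e"
  shows "E_min e i \<longleftrightarrow> ncong c (h e) = ncong c (h i)"
proof -
  have "E_min e i \<longleftrightarrow> (\<forall>k. (\<exists>n\<in>W e. n < k) \<longleftrightarrow> (\<exists>n\<in>W i. n < k))"
    unfolding E_min_def Least_eq_iff_upward by blast
  also have "\<dots> \<longleftrightarrow> (\<forall>a b. ncong c (h e) a b \<longleftrightarrow> ncong c (h i) a b)"
  proof
    have min: "(\<exists>n\<in>A. n < a \<and> n < b) \<longleftrightarrow> (\<exists>n\<in>A. n < min a b)" for A and a b :: nat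
      by simp
    assume "\<forall>k. (\<exists>n\<in>W e. n < k) \<longleftrightarrow> (\<exists>n\<in>W i. n < k)"
    then show "\<forall>a b. ncong c (h e) a b \<longleftrightarrow> ncong c (h i) a b"
      unfolding ncong_shifts_iff[OF assms] min by blast
  next
    \<comment> \<open>The numbers \<open>k\<close> and \<open>Suc k\<close> differ, so they are
      related exactly when some element lies below the smaller one.\<close>
    have Suc: "(\<exists>n\<in>W j. n < k) \<longleftrightarrow> ncong c (h j) k (Suc k)" for j k
      unfolding ncong_shifts_iff[OF assms] by (metis less_SucI n_not_Suc_n)
    assume "\<forall>a b. ncong c (h e) a b \<longleftrightarrow> ncong c (h i) a b"
    then show "\<forall>k. (\<exists>n\<in>W e. n < k) \<longleftrightarrow> (\<exists>n\<in>W i. n < k)"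
      unfolding Suc by blast
  qed
  finally show ?thesis by (simp only: fun_eq_iff)
qed

lemma E_min_reducible_CS1_iso:
  assumes "computable_coding c"
  shows "E_min \<le>\<^sub>c CS1_iso c"
proof -
  define g where "g n = c (pw n, pw (Suc n))" for n
  have \<gamma>: "computable (\<lambda>n. c (inv std_coding n))" and inj: "inj c"
    using assms by (simp_all add: computable_coding_def bij_def)
  have "std_trm (pw n) = rec_nat 0 (\<lambda>_ r. Suc (prod_encode (0, r))) n" for n
    by (induction n) auto
  moreover have "computable (\<lambda>n. rec_nat 0 (\<lambda>_ r. Suc (prod_encode (0, r))) n)"
    by (intro computable_rec computable_basic)
  ultimately have pw: "computable (\<lambda>n. std_trm (pw n))" by simp
  have "computable (\<lambda>n. c (inv std_coding (prod_encode (std_trm (pw n), std_trm (pw (Suc n))))))"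
    by (rule computable_compose[OF \<gamma> computable_pair[OF pw computable_compose[OF pw computable_Suc[OF computable_id]]]])
  then have g: "computable g" by (simp only: inv_std_coding g_def[abs_def])
  have inj_g: "g m = g n \<longleftrightarrow> m = n" for m n
  proof
    assume "g m = g n"
    then have "pw m = pw n" using inj by (simp add: g_def inj_eq)
    then show "m = n" by (metis leaves_pw nat.inject)
  qed simp
  have "decidable (\<lambda>z. g (pi2 z) = pi1 z)"
    by (intro decidable_eq computable_compose[OF g computable_pi2] computable_pi1 computable_id)
  then obtain q where "\<And>x w. run q x = Some w \<longleftrightarrow> g w = x \<and> (\<forall>v<w. g v \<noteq> x)"
    by (rule search_prog[where Q = "\<lambda>x w. g w = x"]) blast
  \<comment> \<open>As \<open>g\<close> is injective, any solution is the least one; thus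
    \<open>q\<close> computes the partial inverse of \<open>g\<close>.\<close>
  then have q: "run q x = Some w \<longleftrightarrow> g w = x" for x w
    using inj_g by (metis order.strict_implies_not_eq)
  \<comment> \<open>Running \<open>q\<close> before program \<open>e\<close> halts exactly on the
    \<open>g\<close>-image of \<open>W e\<close>. The code is computable in \<open>e\<close> because
    \<open>e\<close> itself enters it as the code of its program.\<close>
  define h where "h e = goedel (Comp (inv goedel e) q)" for e
  have "h e = 5 + 4 * prod_encode (e, goedel q)" for e
    by (simp add: h_def surj_f_inv_f[OF surj_goedel])
  moreover have "computable (\<lambda>e. 5 + 4 * prod_encode (e, goedel q))"
    by (intro computable_intros)
  ultimately have h: "computable h" by presburger
  have W_h: "W (h e) = {k. \<exists>n\<in>W e. run q k = Some n}" for e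
    unfolding h_def W_goedel W_def[of e] by (auto simp: bind_eq_Some_conv)
  have Wh: "W (h e) = g ` W e" for e
    unfolding W_h by (auto simp: q)
  have "{p. c p \<in> W (h e)} = (\<lambda>n. (pw n, pw (Suc n))) ` W e" for e
    unfolding Wh using inj by (auto simp: g_def image_iff inj_eq)
  then have "E_min e i \<longleftrightarrow> CS1_iso c (h e) (h i)" for e i
    unfolding CS1_iso_iff by (rule E_min_iff_ncong)
  with h show ?thesis unfolding reducible_def by blast
qed

theorem theorem3p4:
  fixes c :: "trm \<times> trm \<Rightarrow> nat"
  assumes "computable_coding c"
  shows "CS1_iso c \<equiv>\<^sub>c E_min"
  unfolding bireducible_def
  using CS1_iso_reducible_E_min[OF assms] E_min_reducible_CS1_iso[OF assms] by blast

end
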